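(* Let $\lambda$ be a nonzero real number. For every integer $n\ge 0$, $$\mathrm{Bel}_{n,-\lambda}(1)=\sum_{j=0}^{n}\sum_{m=0}^{j}\binom{n}{j}(1)_{n-j,-\lambda}(-1)^{m}d_{m,\lambda}S_{2,-\lambda}(j,m).$$
   Context: For a nonzero real $\mu$ (used below with $\mu=\lambda$ and $\mu=-\lambda$), the degenerate falling factorial is $(x)_{0,\mu}=1$ and $(x)_{n,\mu}=x(x-\mu)\cdots(x-(n-1)\mu)$ for $n\ge1$; the degenerate exponential function is $e_{\mu}^{x}(t)=(1+\mu t)^{x/\mu}=\sum_{n\ge0}(x)_{n,\mu}\frac{t^n}{n!}$ and $e_\mu(t)=e_\mu^1(t)$. The degenerate derangement polynomials $d_{n,\lambda}(x)$ are defined by $\frac{1}{1-t}e_{\lambda}^{x-1}(t)=\sum_{n\ge0}d_{n,\lambda}(x)\frac{t^n}{n!}$, and $d_{n,\lambda}=d_{n,\lambda}(0)$. The fully degenerate Bell polynomials are defined by $e_{\mu}(x(e_{\mu}(t)-1))=\sum_{n\ge0}\mathrm{Bel}_{n,\mu}(x)\frac{t^n}{n!}$. The degenerate Stirling numbers of the second kind are defined by $\frac{1}{m!}(e_{\mu}(t)-1)^m=\sum_{n\ge m}S_{2,\mu}(n,m)\frac{t^n}{n!}$ for $m\ge0$. *)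

theory Defs
  imports Complex_Main "HOL-Computational_Algebra.Formal_Power_Series"
begin

text \<open>All generating functions are formal power series in \<open>t\<close> over the reals.\<close>

unbundle fps_syntax

definition degen_ffact :: "real \<Rightarrow> real \<Rightarrow> nat \<Rightarrow> real" where
  "degen_ffact \<mu> x n = (\<Prod>i<n. x - real i * \<mu>)"

definition degen_exp :: "real \<Rightarrow> real \<Rightarrow> real fps" where
  "degen_exp \<mu> x = Abs_fps (\<lambda>n. degen_ffact \<mu> x n / fact n)"

text \<open>The closed form \<open>(1 + \<mu>t)\<^sup>x\<^sup>/\<^sup>\<mu>\<close>, read as a binomial series.\<close>

lemma degen_exp_eq_binomial:
  assumes "\<mu> \<noteq> 0"
  shows "degen_exp \<mu> x = fps_binomial (x / \<mu>) oo (fps_const \<mu> * fps_X)"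
proof (rule fps_ext)
  fix n
  have "degen_ffact \<mu> x n = (\<Prod>i<n. \<mu> * (x / \<mu> - real i))"
    unfolding degen_ffact_def using assms by (intro prod.cong) (auto simp: field_simps)
  also have "\<dots> = \<mu> ^ n * (\<Prod>i<n. x / \<mu> - real i)"
    by (simp add: prod.distrib)
  finally have "degen_ffact \<mu> x n / fact n = \<mu> ^ n * ((x / \<mu>) gchoose n)"
    by (simp add: gbinomial_prod_rev atLeast0LessThan)
  then show "degen_exp \<mu> x $ n = (fps_binomial (x / \<mu>) oo (fps_const \<mu> * fps_X)) $ n"
    by (simp add: degen_exp_def fps_compose_linear)
qed

definition degen_derangement_poly :: "real \<Rightarrow> nat \<Rightarrow> real \<Rightarrow> real" where
  "degen_derangement_poly \<mu> n x = fact n * (1 / (1 - fps_X) * degen_exp \<mu> (x - 1)) $ n"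

definition degen_derangement :: "real \<Rightarrow> nat \<Rightarrow> real" where
  "degen_derangement \<mu> n = degen_derangement_poly \<mu> n 0"

text \<open>The inner series \<open>x (e\<^sub>\<mu>(t) - 1)\<close> has zero constant term, as \<open>oo\<close> requires.\<close>

definition fully_degen_Bell_poly :: "real \<Rightarrow> nat \<Rightarrow> real \<Rightarrow> real" where
  "fully_degen_Bell_poly \<mu> n x =
     fact n * (degen_exp \<mu> 1 oo (fps_const x * (degen_exp \<mu> 1 - 1))) $ n"

definition degen_Stirling2 :: "real \<Rightarrow> nat \<Rightarrow> nat \<Rightarrow> real" where
  "degen_Stirling2 \<mu> n m = fact n * (fps_const (1 / fact m) * (degen_exp \<mu> 1 - 1) ^ m) $ n"

end

theory Submission
  imports Defs
begin

text \<open>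
  Write \<open>E = e\<^bsub>-\<lambda>\<^esub>(t)\<close> and let \<open>D(t)\<close> be the generating function of the \<open>d\<^bsub>m,\<lambda>\<^esub>\<close>. Since
  \<open>e\<^bsub>\<lambda>\<^esub>\<^bsup>-1\<^esup>(-t) = (1 - \<lambda>t)\<^bsup>-1/\<lambda>\<^esup> = e\<^bsub>-\<lambda>\<^esub>(t)\<close>, replacing \<open>t\<close> by \<open>-t\<close> in
  \<open>(1 - t) D(t) = e\<^bsub>\<lambda>\<^esub>\<^bsup>-1\<^esup>(t)\<close> gives \<open>(1 + t) D(-t) = e\<^bsub>-\<lambda>\<^esub>(t)\<close>. Substituting
  \<open>E - 1\<close> for \<open>t\<close> yields \<open>E \<cdot> D(1 - E) = e\<^bsub>-\<lambda>\<^esub>(E - 1)\<close>, and the claim compares coefficients.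
\<close>

lemma degen_ffact_uminus:
  "degen_ffact (- \<mu>) (- x) n = (- 1) ^ n * degen_ffact \<mu> x n"
proof -
  have "degen_ffact (- \<mu>) (- x) n = (\<Prod>i<n. (- 1) * (x - real i * \<mu>))"
    unfolding degen_ffact_def by (intro prod.cong) auto
  then show ?thesis
    by (simp only: prod.distrib degen_ffact_def) simp
qed

lemma degen_exp_uminus:
  "degen_exp (- \<mu>) (- x) = degen_exp \<mu> x oo - fps_X"
proof -
  \<comment> \<open>With a scalar multiple of \<open>fps_X\<close> inside,
    \<open>fps_compose_linear\<close> gives the coefficients.\<close>
  have "degen_exp (- \<mu>) (- x) = degen_exp \<mu> x oo (fps_const (- 1) * fps_X)"
    unfolding fps_compose_linear
    by (rule fps_ext) (simp add: degen_exp_def degen_ffact_uminus)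
  then show ?thesis
    by (simp add: fps_const_neg[symmetric] del: fps_const_neg)
qed

text \<open>Hence \<open>degen_exp \<mu> x - 1\<close> has zero constant term, so composing with it
  respects products.\<close>

lemma degen_exp_nth_0 [simp]: "degen_exp \<mu> x $ 0 = 1"
  by (simp add: degen_exp_def degen_ffact_def)

lemma degen_derangement_fps:
  "(1 + fps_X) * Abs_fps (\<lambda>m. (- 1) ^ m * degen_derangement \<mu> m / fact m) = degen_exp (- \<mu>) 1"
proof -
  define H where "H = 1 / (1 - fps_X) * degen_exp \<mu> (- 1)"
  have "Abs_fps (\<lambda>m. (- 1) ^ m * degen_derangement \<mu> m / fact m) = H oo (fps_const (- 1) * fps_X)"
    unfolding fps_compose_linear
    by (rule fps_ext) (simp add: degen_derangement_def degen_derangement_poly_def H_def)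
  then have F: "Abs_fps (\<lambda>m. (- 1) ^ m * degen_derangement \<mu> m / fact m) = H oo - fps_X"
    by (simp add: fps_const_neg[symmetric] del: fps_const_neg)
  have "(1 - fps_X) * (1 / (1 - fps_X)) = (1 :: real fps)"
    by (simp add: fps_divide_unit inverse_mult_eq_1')
  then have "degen_exp \<mu> (- 1) = (1 - fps_X) * H"
    unfolding H_def by (metis mult.assoc mult_1)
  then have "degen_exp \<mu> (- 1) oo - fps_X = (1 + fps_X) * (H oo - fps_X)"
    by (simp add: fps_compose_mult_distrib fps_compose_sub_distrib)
  then show ?thesis
    using degen_exp_uminus[of \<mu> "- 1"] F by simp
qed

lemma fully_degen_Bell_fps:
  "degen_exp (- \<mu>) 1 oo (degen_exp (- \<mu>) 1 - 1) =
    degen_exp (- \<mu>) 1 *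
    (Abs_fps (\<lambda>m. (- 1) ^ m * degen_derangement \<mu> m / fact m) oo (degen_exp (- \<mu>) 1 - 1))"
  \<comment> \<open>Only the outer series is expanded; its factor \<open>1 + fps_X\<close> composes
    back to \<open>degen_exp (- \<mu>) 1\<close>.\<close>
  by (subst (1) degen_derangement_fps[symmetric])
     (simp add: fps_compose_mult_distrib fps_compose_add_distrib)

theorem theorem10:
  fixes l :: real and n :: nat
  assumes "l \<noteq> 0"
  shows "fully_degen_Bell_poly (- l) n 1 =
    (\<Sum>j=0..n. \<Sum>m=0..j. real (n choose j) * degen_ffact (- l) 1 (n - j) *
       (- 1) ^ m * degen_derangement l m * degen_Stirling2 (- l) j m)"
proof -
  define E where "E = degen_exp (- l) 1"
  define F where "F = Abs_fps (\<lambda>m. (- 1) ^ m * degen_derangement l m / fact m)"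
  have "fully_degen_Bell_poly (- l) n 1 = fact n * ((F oo (E - 1)) * E) $ n"
    using fully_degen_Bell_fps[of l]
    by (simp add: fully_degen_Bell_poly_def E_def F_def mult.commute)
  also have "\<dots> = (\<Sum>j=0..n. fact n * ((F oo (E - 1)) $ j * E $ (n - j)))"
    by (simp add: fps_mult_nth sum_distrib_left)
  also have "\<dots> = (\<Sum>j=0..n. \<Sum>m=0..j. real (n choose j) * degen_ffact (- l) 1 (n - j) *
       (- 1) ^ m * degen_derangement l m * degen_Stirling2 (- l) j m)"
  proof (rule sum.cong)
    fix j assume "j \<in> {0..n}"
    then have "real (n choose j) = fact n / (fact j * fact (n - j))"
      by (simp add: binomial_fact)
    then show "fact n * ((F oo (E - 1)) $ j * E $ (n - j)) =
      (\<Sum>m=0..j. real (n choose j) * degen_ffact (- l) 1 (n - j) *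
         (- 1) ^ m * degen_derangement l m * degen_Stirling2 (- l) j m)"
      \<comment> \<open>The \<open>fact j\<close> of the Stirling number cancels the one in the
        binomial coefficient; its \<open>1 / fact m\<close> is the one in \<open>F\<close>.\<close>
      by (simp add: fps_compose_nth F_def degen_Stirling2_def E_def[symmetric]
          sum_distrib_left sum_distrib_right)
        (simp add: E_def degen_exp_def mult_ac)
  qed simp
  finally show ?thesis .
qed

end
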